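(* Let $G$ be a finite directed acyclic graph with a unique source $s$ and a unique sink $t$, with no idle edges, satisfying degree equality, and let $(\mathcal{R},\leq)$ be a route decomposition of $G$ with a linear ordering. If $G$ has an inner vertex with indegree at least $3$, then the equatorial flow triangulation $T_{\mathrm{eq}}\ast\Delta_{\mathcal{R}}$ of $\mathcal{F}_1(G)$ is not a DKK triangulation, i.e. it is not equal to the DKK triangulation of $\mathcal{F}_1(G)$ induced by any framing of $G$.
   Context: Directed graphs may have parallel edges. The vertices of $G$ are ordered $s<1<\cdots<n<t$ with every edge $(i,j)$ satisfying $i<j$; $1,\dots,n$ are the inner vertices. An edge is idle if it is the only incoming or the only outgoing edge of some inner vertex. A route is a directed path from $s$ to $t$ (a sequence of edges); $\chi_R\in\mathbb{R}^{E(G)}$ is the indicator vector of a route $R$. The flow polytope $\mathcal{F}_1(G)$ is the set of $x\in\mathbb{R}_{\ge 0}^{E(G)}$ with inflow equal to outflow at every inner vertex and total outflow $1$ at $s$; its vertices are the vectors $\chi_R$. Degree equality: $\mathrm{indeg}_G(v)=\mathrm{outdeg}_G(v)$ for all inner $v$. A route decomposition is a set $\mathcal{R}$ of routes whose edge sets partition $E(G)$. Framings and DKK triangulations. A framing is a choice, for each inner vertex $v$, of linear orders on the set $\mathrm{in}(v)$ of incoming edges and the set $\mathrm{out}(v)$ of outgoing edges. For a route $P$ through $v$, $Pv$ is the part of $P$ from $s$ to $v$ and $vP$ the part from $v$ to $t$. For two distinct directed paths $P,Q$ from $v$ to $t$, let $w$ be the last vertex of their common initial segment starting at $v$; then $P\prec_{\mathrm{Out}(v)}Q$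 if the edge of $P$ leaving $w$ is smaller in $\mathrm{out}(w)$ than the edge of $Q$ leaving $w$. Symmetrically, for two distinct directed paths $P,Q$ from $s$ to $v$, let $w$ be the first vertex of their common final segment ending at $v$; then $P\prec_{\mathrm{In}(v)}Q$ if the edge of $P$ entering $w$ is smaller in $\mathrm{in}(w)$ than the edge of $Q$ entering $w$. Two routes $P,Q$ sharing an inner vertex $v$ are in conflict at $v$ if (up to exchanging $P$ and $Q$) $Pv\prec_{\mathrm{In}(v)}Qv$ and $vQ\prec_{\mathrm{Out}(v)}vP$. Two routes are coherent if they are not in conflict at any common inner vertex. A clique is a set of pairwise coherent routes. The DKK triangulation of $\mathcal{F}_1(G)$ induced by a framing is the triangulation whose simplices are the convex hulls of $\{\chi_R: R\in C\}$ for cliques $C$ (it is a regular unimodular triangulation by a theorem of Danilov, Karzanov and Koshevoy). Equatorial flow triangulation. Given $\mathcal{R}=\{R_1<\cdots<R_k\}$, the route decomposition framing orders the incoming edges, and likewise the outgoing edges, at each inner vertex by the order of the (unique) routes of $\mathcal{R}$ containing them; let $T$ be the induced DKK triangulation. Let $\Gamma$ be the polyhedral subcomplex of $\partial\mathcal{F}_1(G)$ generated by all faces of the form $\bigcap_{R\in\mathcal{R}}F_R$, where each $F_R$ is a facet of $\mathcal{F}_1(G)$ with $\chi_R\notin F_R$; $T_{\mathrm{eq}}:=T|_\Gamma$ is the subcomplex of simplices of $T$ contained in a face of $\Gamma$. Let $\Delta_{\mathcal{R}}=\mathrm{conv}\{\chi_R:R\in\mathcal{R}\}$. The equatorial flow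 triangulation is the join $T_{\mathrm{eq}}\ast\Delta_{\mathcal{R}}$, i.e. the triangulation of $\mathcal{F}_1(G)$ generated by the simplices $\mathrm{conv}(F\cup\Delta_{\mathcal{R}})$ for $F$ a face of $T_{\mathrm{eq}}$. *)

theory Defs
  imports "HOL-Analysis.Analysis" "Graph_Theory.Arc_Walk"
begin

text \<open>
  Graphs are the directed multigraphs of \<^theory>\<open>Graph_Theory.Digraph\<close>. A topological order of the
  vertices is not part of the data, since nothing below depends on the choice; its existence
  is expressed by acyclicity.
\<close>

locale flow_graph = fin_digraph G for G :: "('v, 'e) pre_digraph" (structure) +
  fixes s t :: 'v
  assumes acyclic_arcs: "acyclic (arcs_ends G)"
    and unique_source: "{v \<in> verts G. in_arcs G v = {}} = {s}"
    and unique_sink: "{v \<in> verts G. out_arcs G v = {}} = {t}"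
    and source_neq_sink: "s \<noteq> t"

definition inner_verts :: "('v, 'e) pre_digraph \<Rightarrow> 'v \<Rightarrow> 'v \<Rightarrow> 'v set" where
  "inner_verts G s t = verts G - {s, t}"

definition idle_edge :: "('v, 'e) pre_digraph \<Rightarrow> 'v \<Rightarrow> 'v \<Rightarrow> 'e \<Rightarrow> bool" where
  "idle_edge G s t e \<longleftrightarrow> (\<exists>v\<in>inner_verts G s t. in_arcs G v = {e} \<or> out_arcs G v = {e})"

definition degree_equality :: "('v, 'e) pre_digraph \<Rightarrow> 'v \<Rightarrow> 'v \<Rightarrow> bool" where
  "degree_equality G s t \<longleftrightarrow> (\<forall>v\<in>inner_verts G s t. in_degree G v = out_degree G v)"

definition routes :: "('v, 'e) pre_digraph \<Rightarrow> 'v \<Rightarrow> 'v \<Rightarrow> 'e list set" where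
  "routes G s t = {P. pre_digraph.apath G s P t}"

text \<open>Distinct routes have distinct edge sets, so no injectivity of \<^const>\<open>set\<close> has to be required.\<close>

definition route_decomposition ::
    "('v, 'e) pre_digraph \<Rightarrow> 'v \<Rightarrow> 'v \<Rightarrow> 'e list set \<Rightarrow> bool" where
  "route_decomposition G s t \<R> \<longleftrightarrow> \<R> \<subseteq> routes G s t \<and> partition_on (arcs G) (set ` \<R>)"

text \<open>
  The space of real vectors indexed by the edges is the subspace of \<^typ>\<open>real ^ 'e\<close> on which all
  coordinates outside \<^term>\<open>arcs G\<close> vanish. Faces and facets of a polytope do not depend on the
  ambient space.
\<close>

definition route_vec :: "'e list \<Rightarrow> real ^ 'e::finite" where
  "route_vec P = (\<chi> e. if e \<in> set P then 1 else 0)"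

definition flow_polytope ::
    "('v, 'e::finite) pre_digraph \<Rightarrow> 'v \<Rightarrow> 'v \<Rightarrow> (real ^ 'e) set" where
  "flow_polytope G s t =
    {x. (\<forall>e. 0 \<le> x $ e) \<and> (\<forall>e. e \<notin> arcs G \<longrightarrow> x $ e = 0) \<and>
        (\<forall>v\<in>inner_verts G s t. (\<Sum>e\<in>in_arcs G v. x $ e) = (\<Sum>e\<in>out_arcs G v. x $ e)) \<and>
        (\<Sum>e\<in>out_arcs G s. x $ e) = 1}"

text \<open>
  The linear orders of a framing are reflexive relations. Only their values at inner vertices matter.
\<close>

record ('v, 'e) framing =
  in_ord :: "'v \<Rightarrow> 'e rel"
  out_ord :: "'v \<Rightarrow> 'e rel"

definition is_framing ::
    "('v, 'e) pre_digraph \<Rightarrow> 'v \<Rightarrow> 'v \<Rightarrow> ('v, 'e) framing \<Rightarrow> bool" where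
  "is_framing G s t \<Phi> \<longleftrightarrow>
    (\<forall>v\<in>inner_verts G s t.
       linear_order_on (in_arcs G v) (in_ord \<Phi> v) \<and> linear_order_on (out_arcs G v) (out_ord \<Phi> v))"

text \<open>For a route \<open>P\<close> through an inner vertex \<open>v\<close>, these are the parts \<open>Pv\<close> and \<open>vP\<close> of \<open>P\<close>.\<close>

definition route_upto :: "('v, 'e) pre_digraph \<Rightarrow> 'e list \<Rightarrow> 'v \<Rightarrow> 'e list" where
  "route_upto G P v = takeWhile (\<lambda>e. tail G e \<noteq> v) P"

definition route_from :: "('v, 'e) pre_digraph \<Rightarrow> 'v \<Rightarrow> 'e list \<Rightarrow> 'e list" where
  "route_from G v P = dropWhile (\<lambda>e. tail G e \<noteq> v) P"

text \<open>
  Since \<open>e \<noteq> f\<close>, the list \<open>us\<close> is the full common initial (final) segment of the two paths, and the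
  vertex at which it ends (starts) is \<^term>\<open>tail G e\<close> (\<^term>\<open>head G e\<close>). Two distinct paths from
  \<open>v\<close> to the sink, or from the source to \<open>v\<close>, always have this shape.
\<close>

definition prec_out ::
    "('v, 'e) pre_digraph \<Rightarrow> ('v, 'e) framing \<Rightarrow> 'e list \<Rightarrow> 'e list \<Rightarrow> bool" where
  "prec_out G \<Phi> P Q \<longleftrightarrow>
    (\<exists>us e f ps qs. P = us @ e # ps \<and> Q = us @ f # qs \<and> e \<noteq> f \<and> (e, f) \<in> out_ord \<Phi> (tail G e))"

definition prec_in ::
    "('v, 'e) pre_digraph \<Rightarrow> ('v, 'e) framing \<Rightarrow> 'e list \<Rightarrow> 'e list \<Rightarrow> bool" where
  "prec_in G \<Phi> P Q \<longleftrightarrow>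
    (\<exists>us e f ps qs. P = ps @ e # us \<and> Q = qs @ f # us \<and> e \<noteq> f \<and> (e, f) \<in> in_ord \<Phi> (head G e))"

definition conflict_at ::
    "('v, 'e) pre_digraph \<Rightarrow> ('v, 'e) framing \<Rightarrow> 'v \<Rightarrow> 'e list \<Rightarrow> 'e list \<Rightarrow> bool" where
  "conflict_at G \<Phi> v P Q \<longleftrightarrow>
    prec_in G \<Phi> (route_upto G P v) (route_upto G Q v) \<and>
      prec_out G \<Phi> (route_from G v Q) (route_from G v P) \<or>
    prec_in G \<Phi> (route_upto G Q v) (route_upto G P v) \<and>
      prec_out G \<Phi> (route_from G v P) (route_from G v Q)"

definition coherent ::
    "('v, 'e) pre_digraph \<Rightarrow> 'v \<Rightarrow> 'v \<Rightarrow> ('v, 'e) framing \<Rightarrow> 'e list \<Rightarrow> 'e list \<Rightarrow> bool" where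
  "coherent G s t \<Phi> P Q \<longleftrightarrow>
    (\<forall>v\<in>inner_verts G s t.
       v \<in> set (pre_digraph.awalk_verts G s P) \<and> v \<in> set (pre_digraph.awalk_verts G s Q)
         \<longrightarrow> \<not> conflict_at G \<Phi> v P Q)"

definition clique ::
    "('v, 'e) pre_digraph \<Rightarrow> 'v \<Rightarrow> 'v \<Rightarrow> ('v, 'e) framing \<Rightarrow> 'e list set \<Rightarrow> bool" where
  "clique G s t \<Phi> C \<longleftrightarrow> C \<subseteq> routes G s t \<and> (\<forall>P\<in>C. \<forall>Q\<in>C. coherent G s t \<Phi> P Q)"

text \<open>
  A polyhedral complex is the set of all its faces, of every dimension and including the empty
  face, as for \<^const>\<open>triangulation\<close>; equality of triangulations is equality of these sets.
\<close>

definition DKK_triangulation ::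
    "('v, 'e::finite) pre_digraph \<Rightarrow> 'v \<Rightarrow> 'v \<Rightarrow> ('v, 'e) framing \<Rightarrow> (real ^ 'e) set set" where
  "DKK_triangulation G s t \<Phi> = {convex hull (route_vec ` C) | C. clique G s t \<Phi> C}"

text \<open>The linear order on \<open>\<R>\<close> is given as a reflexive relation \<open>L\<close>.\<close>

definition route_decomposition_framing ::
    "('v, 'e) pre_digraph \<Rightarrow> 'e list set \<Rightarrow> 'e list rel \<Rightarrow> ('v, 'e) framing" where
  "route_decomposition_framing G \<R> L =
    \<lparr>in_ord = (\<lambda>v. {(e, f) \<in> in_arcs G v \<times> in_arcs G v.
                     \<exists>P\<in>\<R>. \<exists>Q\<in>\<R>. e \<in> set P \<and> f \<in> set Q \<and> (P, Q) \<in> L}),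
     out_ord = (\<lambda>v. {(e, f) \<in> out_arcs G v \<times> out_arcs G v.
                      \<exists>P\<in>\<R>. \<exists>Q\<in>\<R>. e \<in> set P \<and> f \<in> set Q \<and> (P, Q) \<in> L})\<rparr>"

definition equatorial_complex ::
    "('v, 'e::finite) pre_digraph \<Rightarrow> 'v \<Rightarrow> 'v \<Rightarrow> 'e list set \<Rightarrow> (real ^ 'e) set set" where
  "equatorial_complex G s t \<R> =
    {A. \<exists>F. (\<forall>R\<in>\<R>. F R facet_of flow_polytope G s t \<and> route_vec R \<notin> F R) \<and>
            A face_of (\<Inter>R\<in>\<R>. F R)}"

definition T_eq ::
    "('v, 'e::finite) pre_digraph \<Rightarrow> 'v \<Rightarrow> 'v \<Rightarrow> 'e list set \<Rightarrow> 'e list rel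
      \<Rightarrow> (real ^ 'e) set set" where
  "T_eq G s t \<R> L =
    {S \<in> DKK_triangulation G s t (route_decomposition_framing G \<R> L).
       \<exists>A\<in>equatorial_complex G s t \<R>. S \<subseteq> A}"

definition equatorial_flow_triangulation ::
    "('v, 'e::finite) pre_digraph \<Rightarrow> 'v \<Rightarrow> 'v \<Rightarrow> 'e list set \<Rightarrow> 'e list rel
      \<Rightarrow> (real ^ 'e) set set" where
  "equatorial_flow_triangulation G s t \<R> L =
    {S. \<exists>F\<in>T_eq G s t \<R> L. S face_of convex hull (F \<union> convex hull (route_vec ` \<R>))}"

end

(* If the two triangulations agree, every route P is coherent, for the framing, with all routes of
   the decomposition: P lies in some maximal simplex, and all of these contain the simplex spanned
   by the decomposition. At an inner vertex v of indegree at least 3 let A, B, C be three routes of the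
   decomposition whose edges into v are in increasing order; by coherence their edges out of v are
   in increasing order too. But then the route that follows A up to v and C from there on is in
   conflict with B at v. *)
theory Submission
  imports Defs
begin

lemma linear_order_on_chain3:
  assumes "linear_order_on A r" and "3 \<le> card A"
  obtains a b c where "a \<in> A" "b \<in> A" "c \<in> A" "a \<noteq> b" "b \<noteq> c" "a \<noteq> c"
    "(a, b) \<in> r" "(b, c) \<in> r"
proof -
  obtain B where "B \<subseteq> A" "card B = 3"
    using assms(2) by (meson obtain_subset_with_card_n)
  then obtain x y z where xyz: "x \<in> A" "y \<in> A" "z \<in> A" "x \<noteq> y" "y \<noteq> z" "x \<noteq> z"
    by (auto simp: card_3_iff)
  have total: "(u, w) \<in> r \<or> (w, u) \<in> r" if "u \<in> A" "w \<in> A" "u \<noteq> w" for u w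
    using assms(1) that by (auto simp: linear_order_on_def total_on_def)
  have "trans r"
    using assms(1) by (simp add: linear_order_on_def partial_order_on_def preorder_on_def)
  with xyz total[of x y] total[of y z] total[of x z] that show thesis
    by metis
qed

text \<open>Vectors with entries 0 and 1 are vertices of the cube, so none is a convex combination
  of others. Only edge sets are compared, since \<open>route_vec\<close> forgets the order of the
  edges in the list.\<close>

lemma route_vec_in_convex_hull:
  assumes "route_vec P \<in> convex hull (route_vec ` C)"
  obtains Q where "Q \<in> C" "set Q = set P"
proof (rule ccontr)
  assume "\<not> thesis"
  then have ne: "set Q \<noteq> set P" if "Q \<in> C" for Q
    using that \<open>\<And>Q. Q \<in> C \<Longrightarrow> set Q = set P \<Longrightarrow> thesis\<close> by blast
  \<comment> \<open>Among 0/1 vectors, the functional with this normal is maximal exactly at the vector of \<open>P\<close>.\<close>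
  define a :: "real ^ 'a" where "a = (\<chi> e. if e \<in> set P then 1 else - 1)"
  have inner: "a \<bullet> route_vec Q = (\<Sum>e\<in>UNIV. if e \<in> set Q then if e \<in> set P then 1 else - 1 else 0)"
    for Q :: "'a list"
    by (auto simp: a_def inner_vec_def route_vec_def intro!: sum.cong)
  have "a \<bullet> route_vec Q < a \<bullet> route_vec P" if "Q \<in> C" for Q
  proof -
    from ne[OF that] obtain e where "(e \<in> set Q) \<noteq> (e \<in> set P)"
      by blast
    \<comment> \<open>Each edge contributes at most as much for \<open>Q\<close> as for
      \<open>P\<close>, and strictly less when it lies in exactly one of the two.\<close>
    then show ?thesis
      unfolding inner by (intro sum_strict_mono_ex1) (auto intro!: bexI[of _ e])
  qed
  then have "route_vec ` C \<subseteq> {x. a \<bullet> x < a \<bullet> route_vec P}"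
    by blast
  then have "convex hull (route_vec ` C) \<subseteq> {x. a \<bullet> x < a \<bullet> route_vec P}"
    by (intro hull_minimal convex_halfspace_lt)
  with assms show False
    by blast
qed

lemma coherent_refl: "coherent G s t \<Phi> P P"
  by (auto simp: coherent_def conflict_at_def prec_in_def)

lemma singleton_route_vec_in_DKK_triangulation:
  assumes "P \<in> routes G s t"
  shows "{route_vec P} \<in> DKK_triangulation G s t \<Phi>"
  using assms by (auto simp: DKK_triangulation_def clique_def coherent_refl intro!: exI[of _ "{P}"])

text \<open>The condition on tails makes \<open>f\<close> the first edge leaving \<open>v\<close>,
  which is exactly where \<open>route_upto\<close> and \<open>route_from\<close> cut the
  list.\<close>

definition (in pre_digraph) splits_at ::
    "'b list \<Rightarrow> 'a \<Rightarrow> 'b list \<Rightarrow> 'b \<Rightarrow> 'b \<Rightarrow> 'b list \<Rightarrow> bool" where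
  "splits_at P v p e f q \<longleftrightarrow>
    P = p @ e # f # q \<and> head G e = v \<and> tail G f = v \<and> (\<forall>x\<in>set (p @ [e]). tail G x \<noteq> v)"

context wf_digraph
begin

text \<open>A path leaves each vertex at most once. Hence its first edge is the only one in its edge
  set with tail \<open>u\<close>; once this edge is deleted from both paths, induction
  applies.\<close>

lemma apath_eqI_set:
  assumes "apath u P w" "apath u Q w" "set P = set Q"
  shows "P = Q"
  using assms
proof (induction P arbitrary: u Q)
  case (Cons e P)
  then obtain f Q' where Q: "Q = f # Q'"
    by (cases Q) auto
  have notin: "tail G e \<notin> tail G ` set P" "tail G f \<notin> tail G ` set Q'"
    using Cons.prems(1,2) by (auto simp: Q apath_simps dest: awalk_verts_arc1)
  have "tail G e = tail G f"
    using Cons.prems(1,2) by (simp add: Q apath_simps)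
  with notin Cons.prems(3) have "e = f"
    unfolding Q by auto
  moreover from this notin Cons.prems(3) have "set P = set Q'"
    unfolding Q by (metis image_eqI insert_ident list.simps(15))
  ultimately show ?case
    using Cons by (auto simp: Q apath_simps)
qed simp

lemma acyclic_apathI:
  assumes "acyclic (arcs_ends G)" "awalk u p v"
  shows "apath u p v"
proof (rule ccontr)
  assume "\<not> apath u p v"
  with assms(2) have "\<not> distinct (awalk_verts u p)"
    by (simp add: apath_def)
  from awalk_not_distinct_decomp[OF assms(2) this] obtain r w where "awalk w r w" "r \<noteq> []"
    by (auto simp: closed_w_def)
  then have "w \<rightarrow>\<^sup>+ w"
    by (auto simp: reachable1_awalk)
  with assms(1) show False
    by (auto simp: acyclic_def)
qed

text \<open>The path cannot stop at \<open>v\<close>, which differs from its endpoint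
  \<open>w\<close>, so some edge follows \<open>e\<close>.\<close>

lemma apath_splits_at:
  assumes "apath u P w" "e \<in> set P" "head G e = v" "v \<noteq> w"
  obtains p f q where "splits_at P v p e f q"
proof -
  from assms(2) obtain p q' where P: "P = p @ e # q'"
    by (auto simp: in_set_conv_decomp)
  have "awalk v q' w"
    using assms(1,3) by (simp add: P apath_def awalk_simps)
  with assms(4) obtain f q where q': "q' = f # q" "tail G f = v"
    by (cases q') (auto simp: awalk_simps)
  \<comment> \<open>The tails are all vertices of the path except the last, so they inherit
    distinctness.\<close>
  have "distinct (map (tail G) P)"
    using assms(1) by (auto simp: apath_def awalk_verts_conv P)
  then have "\<forall>x\<in>set (p @ [e]). tail G x \<noteq> tail G f"
    by (simp add: P q'(1)) (metis imageI)
  then have "splits_at P v p e f q"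
    using assms(3) q' by (simp add: splits_at_def P)
  then show thesis
    by (rule that)
qed

end

context pre_digraph
begin

lemma route_upto_splits_at: "splits_at P v p e f q \<Longrightarrow> route_upto G P v = p @ [e]"
  by (auto simp: splits_at_def route_upto_def takeWhile_append)

lemma route_from_splits_at: "splits_at P v p e f q \<Longrightarrow> route_from G v P = f # q"
  by (auto simp: splits_at_def route_from_def dropWhile_append)

lemma splits_at_unique_in:
  assumes "splits_at P v p e f q" "splits_at P v p' e' f' q'"
  shows "e = e'"
  using route_upto_splits_at[OF assms(1)] route_upto_splits_at[OF assms(2)] by simp

lemma splits_at_recombine:
  assumes "splits_at P v p e f q" "splits_at P' v p' e' f' q'"
  shows "splits_at (p @ e # f' # q') v p e f' q'"
  using assms by (auto simp: splits_at_def)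

lemma splits_at_in_awalk_verts:
  assumes "splits_at P v p e f q"
  shows "v \<in> set (awalk_verts u P)"
  using assms by (auto simp: splits_at_def awalk_verts_conv)

text \<open>As the two paths differ in both edges at \<open>v\<close>, their common segments ending
  and starting at \<open>v\<close> are empty. A conflict at \<open>v\<close> is thus decided by the
  framing at \<open>v\<close> alone, with \<open>us\<close> instantiated to
  \<open>[]\<close>.\<close>

lemma coherent_splits_atD:
  assumes "coherent G s t \<Phi> P Q" "v \<in> inner_verts G s t"
    and P: "splits_at P v p e f q" and Q: "splits_at Q v p' e' f' q'"
    and "e \<noteq> e'" "f \<noteq> f'" "(e, e') \<in> in_ord \<Phi> v"
  shows "(f', f) \<notin> out_ord \<Phi> v"
proof
  assume *: "(f', f) \<in> out_ord \<Phi> v"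
  have "head G e = v" "tail G f' = v"
    using P Q by (auto simp: splits_at_def)
  with assms * have "prec_in G \<Phi> (p @ [e]) (p' @ [e'])" "prec_out G \<Phi> (f' # q') (f # q)"
    by (auto simp: prec_in_def prec_out_def intro!: exI[of _ "[]"])
  then have "conflict_at G \<Phi> v P Q"
    by (simp add: conflict_at_def route_upto_splits_at[OF P] route_upto_splits_at[OF Q]
        route_from_splits_at[OF P] route_from_splits_at[OF Q])
  with assms(1,2) splits_at_in_awalk_verts[OF P] splits_at_in_awalk_verts[OF Q] show False
    by (auto simp: coherent_def)
qed

end

text \<open>Concatenation gives only a walk from \<open>s\<close> to \<open>t\<close>; acyclicity
  excludes repeated vertices.\<close>

lemma (in flow_graph) route_recombine:
  assumes "P \<in> routes G s t" "P' \<in> routes G s t"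
    and P: "splits_at P v p e f q" and P': "splits_at P' v p' e' f' q'"
  shows "p @ e # f' # q' \<in> routes G s t"
proof -
  have "awalk s P t" "awalk s P' t"
    using assms(1,2) by (auto simp: routes_def apath_def)
  then have "awalk s (p @ [e]) v" "awalk v (f' # q') t"
    using P P' by (auto simp: splits_at_def awalk_simps)
  then have "awalk s ((p @ [e]) @ f' # q') t"
    by (rule awalk_appendI)
  then show ?thesis
    using acyclic_apathI[OF acyclic_arcs] by (simp add: routes_def)
qed

lemma equatorial_eq_DKK_imp_coherent:
  fixes G :: "('v, 'e::finite) pre_digraph"
  assumes "wf_digraph G"
    and eq: "equatorial_flow_triangulation G s t \<R> L = DKK_triangulation G s t \<Phi>"
    and sub: "\<R> \<subseteq> routes G s t" and P: "P \<in> routes G s t" and R: "R \<in> \<R>"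
  shows "coherent G s t \<Phi> P R"
proof -
  interpret wf_digraph G
    by fact
  have "{route_vec P} \<in> equatorial_flow_triangulation G s t \<R> L"
    unfolding eq by (rule singleton_route_vec_in_DKK_triangulation) (rule P)
  then obtain F where F: "F \<in> T_eq G s t \<R> L"
    and face: "{route_vec P} face_of convex hull (F \<union> convex hull (route_vec ` \<R>))"
    by (auto simp: equatorial_flow_triangulation_def)
  define S where "S = convex hull (F \<union> convex hull (route_vec ` \<R>))"
  \<comment> \<open>The generating simplex is itself a member of the triangulation, hence by
    \<open>eq\<close> the hull of a clique.\<close>
  have "S face_of S"
    by (simp add: S_def face_of_refl)
  with F have "S \<in> equatorial_flow_triangulation G s t \<R> L"
    by (auto simp: equatorial_flow_triangulation_def S_def)
  then obtain C where C: "clique G s t \<Phi> C" and S: "S = convex hull (route_vec ` C)"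
    unfolding eq by (auto simp: DKK_triangulation_def)
  \<comment> \<open>A route whose vector lies in the simplex must belong to the clique: the hull
    lemma yields a member with the same edges, and these determine the route.\<close>
  have in_C: "Q \<in> C" if "route_vec Q \<in> S" "Q \<in> routes G s t" for Q
  proof -
    from that(1) obtain Q' where "Q' \<in> C" "set Q' = set Q"
      unfolding S by (rule route_vec_in_convex_hull)
    moreover from this have "Q' = Q"
      using C that(2) by (intro apath_eqI_set[of s _ t]) (auto simp: clique_def routes_def)
    ultimately show ?thesis
      by simp
  qed
  have "route_vec P \<in> S"
    using face_of_imp_subset[OF face] by (simp add: S_def)
  moreover have "route_vec R \<in> S"
    using R unfolding S_def by (intro hull_inc UnI2 imageI)
  ultimately show ?thesis
    using C in_C sub P R by (auto simp: clique_def)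
qed

theorem theorem4p14:
  fixes G :: "('v, 'e::finite) pre_digraph" and s t :: 'v
    and \<R> :: "'e list set" and L :: "'e list rel"
  assumes "flow_graph G s t"
    and "\<forall>e\<in>arcs G. \<not> idle_edge G s t e"
    and "degree_equality G s t"
    and "route_decomposition G s t \<R>"
    and "linear_order_on \<R> L"
    and "\<exists>v\<in>inner_verts G s t. 3 \<le> in_degree G v"
  shows "\<forall>\<Phi>. is_framing G s t \<Phi> \<longrightarrow>
           equatorial_flow_triangulation G s t \<R> L \<noteq> DKK_triangulation G s t \<Phi>"
proof (intro allI impI notI)
  fix \<Phi>
  assume framing: "is_framing G s t \<Phi>"
    and eq: "equatorial_flow_triangulation G s t \<R> L = DKK_triangulation G s t \<Phi>"
  interpret flow_graph G s t
    by fact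
  have sub: "\<R> \<subseteq> routes G s t" and part: "partition_on (arcs G) (set ` \<R>)"
    using assms(4) by (auto simp: route_decomposition_def)
  have coh: "coherent G s t \<Phi> P R" if "P \<in> routes G s t" "R \<in> \<R>" for P R
    using wf_digraph_axioms eq sub that by (rule equatorial_eq_DKK_imp_coherent)
  obtain v where v: "v \<in> inner_verts G s t" and deg: "3 \<le> card (in_arcs G v)"
    using assms(6) by (auto simp: in_degree_def)
  have in_lin: "linear_order_on (in_arcs G v) (in_ord \<Phi> v)"
    and out_lin: "linear_order_on (out_arcs G v) (out_ord \<Phi> v)"
    using framing v by (auto simp: is_framing_def)
  \<comment> \<open>The decomposition covers all edges, and its routes end at \<open>t\<close>, so
    they pass on through the inner vertex \<open>v\<close>.\<close>
  have split: "\<exists>R p f q. R \<in> \<R> \<and> splits_at R v p e f q" if e: "e \<in> in_arcs G v" for e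
  proof -
    obtain R where R: "R \<in> \<R>" "e \<in> set R"
      using e partition_onD1[OF part] by auto
    then have "apath s R t"
      using sub by (auto simp: routes_def)
    then obtain p f q where "splits_at R v p e f q"
      using apath_splits_at[of s R t e v] R e v by (auto simp: inner_verts_def)
    with R(1) show ?thesis
      by blast
  qed
  \<comment> \<open>A shared outgoing edge would force the two blocks of the partition, hence the
    two routes, to coincide; but a route enters \<open>v\<close> by one edge only.\<close>
  have distinct_out: "f \<noteq> f'"
    if "R \<in> \<R>" "R' \<in> \<R>" "splits_at R v p e f q" "splits_at R' v p' e' f' q'" "e \<noteq> e'"
    for R R' p p' e e' f f' q q'
  proof
    assume "f = f'"
    then have "f \<in> set R \<inter> set R'"
      using that by (auto simp: splits_at_def)
    then have "set R = set R'"
      using that(1,2) partition_onD2[OF part] by (auto simp: disjoint_def)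
    then have "R = R'"
      using that(1,2) sub by (intro apath_eqI_set[of s _ t]) (auto simp: routes_def)
    with that show False
      using splits_at_unique_in by blast
  qed
  \<comment> \<open>Coherence within the decomposition excludes the reverse order, and totality
    leaves this one.\<close>
  have out_mono: "(f, f') \<in> out_ord \<Phi> v"
    if "R \<in> \<R>" "R' \<in> \<R>" "splits_at R v p e f q" "splits_at R' v p' e' f' q'" "e \<noteq> e'"
      "(e, e') \<in> in_ord \<Phi> v"
    for R R' p p' e e' f f' q q'
  proof -
    have "f \<noteq> f'"
      using that distinct_out by blast
    moreover have "set R \<subseteq> arcs G" "set R' \<subseteq> arcs G"
      using that(1,2) partition_onD1[OF part] by auto
    then have "f \<in> out_arcs G v" "f' \<in> out_arcs G v"
      using that by (auto simp: splits_at_def)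
    moreover have "(f', f) \<notin> out_ord \<Phi> v"
      using coherent_splits_atD[OF coh v] that sub \<open>f \<noteq> f'\<close> by blast
    ultimately show ?thesis
      using out_lin unfolding linear_order_on_def total_on_def by blast
  qed
  obtain a b c where abc: "a \<in> in_arcs G v" "b \<in> in_arcs G v" "c \<in> in_arcs G v"
    "a \<noteq> b" "b \<noteq> c" "a \<noteq> c" "(a, b) \<in> in_ord \<Phi> v" "(b, c) \<in> in_ord \<Phi> v"
    using linear_order_on_chain3[OF in_lin deg] .
  obtain A pa fa qa where A: "A \<in> \<R>" "splits_at A v pa a fa qa"
    using split[OF abc(1)] by blast
  obtain B pb fb qb where B: "B \<in> \<R>" "splits_at B v pb b fb qb"
    using split[OF abc(2)] by blast
  obtain C pc fc qc where C: "C \<in> \<R>" "splits_at C v pc c fc qc"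
    using split[OF abc(3)] by blast
  \<comment> \<open>This route enters \<open>v\<close> below \<open>B\<close> but leaves it above
    \<open>B\<close>.\<close>
  have "pa @ a # fc # qc \<in> routes G s t"
    using A C sub by (blast intro: route_recombine)
  then have "coherent G s t \<Phi> (pa @ a # fc # qc) B"
    using B(1) by (rule coh)
  moreover have "fc \<noteq> fb"
    using distinct_out B C abc(5) by blast
  ultimately have "(fb, fc) \<notin> out_ord \<Phi> v"
    using coherent_splits_atD[OF _ v splits_at_recombine[OF A(2) C(2)] B(2)] abc(4,7) by blast
  with out_mono[OF B(1) C(1) B(2) C(2) abc(5,8)] show False
    by contradiction
qed

end
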